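(* The Radon inequality and the weighted power mean inequality are equivalent, i.e. each of the following two (universally quantified) assertions can be deduced from the other. (Radon inequality) For every integer $n\ge 1$, all positive real numbers $b_1,\ldots,b_n$, all nonnegative real numbers $a_1,\ldots,a_n$ and every real $m\ge 0$, $$\frac{a_1^{m+1}}{b_1^{m}}+\frac{a_2^{m+1}}{b_2^{m}}+\cdots+\frac{a_n^{m+1}}{b_n^{m}}\ \ge\ \frac{(a_1+a_2+\cdots+a_n)^{m+1}}{(b_1+b_2+\cdots+b_n)^{m}}.$$ (Weighted power mean inequality) For every integer $n\ge 1$, all nonnegative real numbers $x_1,\ldots,x_n$, all positive real numbers $p_1,\ldots,p_n$ and all real $r\ge s>0$, $$\left(\frac{p_1x_1^r+p_2x_2^r+\cdots+p_nx_n^r}{p_1+p_2+\cdots+p_n}\right)^{\frac1r}\ \ge\ \left(\frac{p_1x_1^s+p_2x_2^s+\cdots+p_nx_n^s}{p_1+p_2+\cdots+p_n}\right)^{\frac1s}.$$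
   Context: "Equivalent" means that each inequality, assumed for all admissible values of its variables, implies the other for all admissible values of its variables. Powers are real powers of nonnegative real numbers. *)

theory Defs
  imports Complex_Main
begin

end

theory Submission
  imports Defs
begin

text \<open>
  Write \<open>A\<close>, \<open>B\<close>, \<open>P\<close> for the sums of the \<open>a\<^sub>i\<close>, \<open>b\<^sub>i\<close>, \<open>p\<^sub>i\<close>. Since
  \<open>a powr (m + 1) / b powr m = b * (a / b) powr (m + 1)\<close>
  (\<open>powr_perspective\<close>), Radon's inequality says
  \<open>(A / B) powr (m + 1) \<le> (\<Sum>i. b\<^sub>i * (a\<^sub>i / b\<^sub>i) powr (m + 1)) / B\<close>.
  This is the power mean inequality with weights \<open>b\<^sub>i\<close>, points \<open>a\<^sub>i / b\<^sub>i\<close> and exponents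
  \<open>r = m + 1\<close>, \<open>s = 1\<close>, raised to the power \<open>m + 1\<close>. Conversely, the power mean inequality for
  \<open>r \<ge> s > 0\<close> is Radon's inequality for \<open>b\<^sub>i = p\<^sub>i\<close>, \<open>a\<^sub>i = p\<^sub>i * x\<^sub>i powr s\<close> and
  \<open>m = r / s - 1\<close>, divided by \<open>P\<close> and raised to the power \<open>1 / r\<close>. Neither direction
  uses convexity: each inequality is deduced from an instance of the other with the same
  \<open>n\<close>.
\<close>

lemma powr_perspective:
  fixes a b m :: real
  assumes "a \<ge> 0" "b > 0"
  shows "a powr (m + 1) / b powr m = b * (a / b) powr (m + 1)"
  using assms by (simp add: powr_divide powr_add)

lemma power_mean_from_radon:
  fixes x p :: "nat \<Rightarrow> real" and r s :: real
  assumes radon: "\<And>(a :: nat \<Rightarrow> real) (b :: nat \<Rightarrow> real) (m::real).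
      \<forall>i\<in>{1..n}. b i > 0 \<Longrightarrow> \<forall>i\<in>{1..n}. a i \<ge> 0 \<Longrightarrow> m \<ge> 0 \<Longrightarrow>
      (\<Sum>i=1..n. a i) powr (m + 1) / (\<Sum>i=1..n. b i) powr m
        \<le> (\<Sum>i=1..n. a i powr (m + 1) / b i powr m)"
    and n: "n \<ge> 1" and p: "\<forall>i\<in>{1..n}. p i > 0"
    and rs: "r \<ge> s" "s > 0"
  shows "((\<Sum>i=1..n. p i * x i powr s) / (\<Sum>i=1..n. p i)) powr (1 / s)
    \<le> ((\<Sum>i=1..n. p i * x i powr r) / (\<Sum>i=1..n. p i)) powr (1 / r)"
proof -
  define P where "P = (\<Sum>i=1..n. p i)"
  define S where "S = (\<Sum>i=1..n. p i * x i powr s)"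
  define R where "R = (\<Sum>i=1..n. p i * x i powr r)"
  have P: "P > 0"
    unfolding P_def using n p by (intro sum_pos) auto
  have S: "S \<ge> 0"
    unfolding S_def using p by (intro sum_nonneg mult_nonneg_nonneg) (auto intro: less_imp_le)
  have "(\<Sum>i=1..n. (p i * x i powr s) powr (r / s - 1 + 1) / p i powr (r / s - 1)) = R"
    unfolding R_def
  proof (rule sum.cong)
    fix i assume "i \<in> {1..n}"
    then have i: "p i > 0" using p by simp
    have "(p i * x i powr s) powr (r / s - 1 + 1) / p i powr (r / s - 1)
        = p i * (p i * x i powr s / p i) powr (r / s - 1 + 1)"
      using i by (intro powr_perspective) simp_all
    also have "\<dots> = p i * x i powr r"
      using i rs by (simp add: powr_powr)
    finally show "(p i * x i powr s) powr (r / s - 1 + 1) / p i powr (r / s - 1)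
        = p i * x i powr r" .
  qed simp
  moreover have "S powr (r / s - 1 + 1) / P powr (r / s - 1)
      \<le> (\<Sum>i=1..n. (p i * x i powr s) powr (r / s - 1 + 1) / p i powr (r / s - 1))"
    unfolding S_def P_def using p rs by (intro radon) (auto intro: less_imp_le)
  ultimately have "P * (S / P) powr (r / s) \<le> R"
    using powr_perspective[OF S P, of "r / s - 1"] by simp
  then have "(S / P) powr (r / s) \<le> R / P"
    using P by (simp add: field_simps)
  then have "((S / P) powr (r / s)) powr (1 / r) \<le> (R / P) powr (1 / r)"
    using rs by (intro powr_mono2) auto
  then show ?thesis
    using rs by (simp add: powr_powr P_def S_def R_def)
qed

text \<open>The comparison of the mean of order \<open>r \<ge> 1\<close> with the arithmetic mean
  (\<open>s = 1\<close>) suffices for Radon's inequality.\<close>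

lemma radon_from_power_mean:
  fixes a b :: "nat \<Rightarrow> real" and m :: real
  assumes power_mean: "\<And>(x :: nat \<Rightarrow> real) (p :: nat \<Rightarrow> real) (r::real).
      \<forall>i\<in>{1..n}. x i \<ge> 0 \<Longrightarrow> \<forall>i\<in>{1..n}. p i > 0 \<Longrightarrow> r \<ge> 1 \<Longrightarrow>
      (\<Sum>i=1..n. p i * x i) / (\<Sum>i=1..n. p i)
        \<le> ((\<Sum>i=1..n. p i * x i powr r) / (\<Sum>i=1..n. p i)) powr (1 / r)"
    and n: "n \<ge> 1" and b: "\<forall>i\<in>{1..n}. b i > 0" and a: "\<forall>i\<in>{1..n}. a i \<ge> 0"
    and m: "m \<ge> 0"
  shows "(\<Sum>i=1..n. a i) powr (m + 1) / (\<Sum>i=1..n. b i) powr m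
    \<le> (\<Sum>i=1..n. a i powr (m + 1) / b i powr m)"
proof -
  define A where "A = (\<Sum>i=1..n. a i)"
  define B where "B = (\<Sum>i=1..n. b i)"
  define R where "R = (\<Sum>i=1..n. b i * (a i / b i) powr (m + 1))"
  have B: "B > 0"
    unfolding B_def using n b by (intro sum_pos) auto
  have A: "A \<ge> 0"
    unfolding A_def using a by (intro sum_nonneg) auto
  have R: "R \<ge> 0"
    unfolding R_def using b by (intro sum_nonneg mult_nonneg_nonneg) (auto intro: less_imp_le)
  have "(\<Sum>i=1..n. b i * (a i / b i)) = A"
    unfolding A_def using b by (intro sum.cong) force+
  moreover have "(\<Sum>i=1..n. b i * (a i / b i)) / B \<le> (R / B) powr (1 / (m + 1))"
    unfolding B_def R_def using a b m
    by (intro power_mean) (auto intro: divide_nonneg_pos)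
  ultimately have "(A / B) powr (m + 1) \<le> ((R / B) powr (1 / (m + 1))) powr (m + 1)"
    using A B m by (intro powr_mono2) auto
  also have "\<dots> = R / B"
    using R B m by (simp add: powr_powr)
  finally have "B * (A / B) powr (m + 1) \<le> R"
    using B by (simp add: field_simps)
  moreover have "R = (\<Sum>i=1..n. a i powr (m + 1) / b i powr m)"
    unfolding R_def using a b by (intro sum.cong) (simp_all add: powr_perspective)
  ultimately show ?thesis
    using powr_perspective[OF A B, of m] by (simp add: A_def B_def)
qed

theorem theorem2p2:
  shows
    "(\<forall>(n::nat) (a::nat \<Rightarrow> real) (b::nat \<Rightarrow> real) (m::real).
        n \<ge> 1 \<longrightarrow> (\<forall>i\<in>{1..n}. b i > 0) \<longrightarrow> (\<forall>i\<in>{1..n}. a i \<ge> 0) \<longrightarrow> m \<ge> 0 \<longrightarrow>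
        (\<Sum>i=1..n. a i powr (m + 1) / b i powr m)
          \<ge> (\<Sum>i=1..n. a i) powr (m + 1) / (\<Sum>i=1..n. b i) powr m)
     \<longleftrightarrow>
     (\<forall>(n::nat) (x::nat \<Rightarrow> real) (p::nat \<Rightarrow> real) (r::real) (s::real).
        n \<ge> 1 \<longrightarrow> (\<forall>i\<in>{1..n}. x i \<ge> 0) \<longrightarrow> (\<forall>i\<in>{1..n}. p i > 0) \<longrightarrow> r \<ge> s \<longrightarrow> s > 0 \<longrightarrow>
        ((\<Sum>i=1..n. p i * x i powr r) / (\<Sum>i=1..n. p i)) powr (1 / r)
          \<ge> ((\<Sum>i=1..n. p i * x i powr s) / (\<Sum>i=1..n. p i)) powr (1 / s))"
proof (rule iffI, goal_cases)
  case 1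
  then show ?case
    by (intro allI impI power_mean_from_radon) simp_all
next
  case 2
  have power_mean: "(\<Sum>i=1..n. p i * x i) / (\<Sum>i=1..n. p i)
      \<le> ((\<Sum>i=1..n. p i * x i powr r) / (\<Sum>i=1..n. p i)) powr (1 / r)"
    if n: "n \<ge> 1" and x: "\<forall>i\<in>{1..n}. x i \<ge> 0" and p: "\<forall>i\<in>{1..n}. p i > 0" and r: "r \<ge> 1"
    for n :: nat and x p :: "nat \<Rightarrow> real" and r :: real
  proof -
    have "(\<Sum>i=1..n. p i * x i powr 1) = (\<Sum>i=1..n. p i * x i)"
      using x by (intro sum.cong) auto
    moreover have "(\<Sum>i=1..n. p i * x i) / (\<Sum>i=1..n. p i) \<ge> 0"
      using x p by (intro divide_nonneg_nonneg sum_nonneg mult_nonneg_nonneg)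
        (auto intro: less_imp_le)
    ultimately show ?thesis
      using 2[rule_format, of n x p 1 r] n x p r by (simp del: abs_divide)
  qed
  then show ?case
    by (intro allI impI radon_from_power_mean) simp_all
qed

end
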